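(* Let $f:\mathbb{Z}_+\to\mathbb{C}$ and $F(x)=1+\sum_{\ell=1}^\infty f(\ell)x^\ell$. Then for every $k\in\mathbb{Z}_+$ and $n\in\mathbb{Z}_{\geq0}$, \[s_n:=\sum_{S\in\mathcal{S}_n^{(k)}}\prod_{i=1}^{|\mathbf{u}(S)|}f(\mathbf{u}(S)_i)=\frac{1}{kn+1}[x^n](1+x)^{kn+1}F(x)^{kn+1},\] and the generating function $S(x)=\sum_{n\geq0}s_nx^n$ satisfies $S(x)=F(xS(x)^k)(1+xS(x)^k)$.
   Context: For $k\in\mathbb{Z}_+$, $\mathcal{S}_n^{(k)}$ (the $k$-Schröder paths of size $n$) is the set of lattice paths from $(0,0)$ to $((k+1)n,0)$ with step set $\{(1,k),(2,k-1),(1,-1)\}$ that never go below the $x$-axis. For $S\in\mathcal{S}_n^{(k)}$, $\mathbf{u}(S)$ is the vector recording, in order, the lengths of the maximal blocks of consecutive $(1,k)$ steps in $S$. Empty products equal $1$. *)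

theory Defs
  imports Complex_Main "HOL-Computational_Algebra.Formal_Power_Series"
begin

text \<open>A lattice path starting at the origin is represented by the list of its steps.\<close>

definition schroeder_steps :: "nat \<Rightarrow> (int \<times> int) set" where
  "schroeder_steps k = {(1, int k), (2, int k - 1), (1, -1)}"

text \<open>For \<open>k > 0\<close>, the path stays weakly above the axis iff all its vertices do; these are the
  partial sums of the steps.\<close>

definition schroeder_paths :: "nat \<Rightarrow> nat \<Rightarrow> (int \<times> int) list set" where
  "schroeder_paths k n =
    {p. set p \<subseteq> schroeder_steps k
      \<and> (\<Sum>s\<leftarrow>p. fst s) = int ((k + 1) * n)
      \<and> (\<Sum>s\<leftarrow>p. snd s) = 0
      \<and> (\<forall>m \<le> length p. 0 \<le> (\<Sum>s\<leftarrow>take m p. snd s))}"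

lemma finite_schroeder_paths: "finite (schroeder_paths k n)"
proof -
  have len: "int (length p) \<le> (\<Sum>s\<leftarrow>p. fst s)" if "set p \<subseteq> schroeder_steps k" for p
    using that by (induction p) (auto simp: schroeder_steps_def)
  have "schroeder_paths k n \<subseteq> {p. set p \<subseteq> schroeder_steps k \<and> length p \<le> (k + 1) * n}"
  proof
    fix p assume "p \<in> schroeder_paths k n"
    then have "set p \<subseteq> schroeder_steps k" "(\<Sum>s\<leftarrow>p. fst s) = int ((k + 1) * n)"
      by (simp_all add: schroeder_paths_def)
    with len[of p] show "p \<in> {p. set p \<subseteq> schroeder_steps k \<and> length p \<le> (k + 1) * n}"
      by (metis (mono_tags, lifting) mem_Collect_eq of_nat_le_iff)
  qed
  moreover have "finite (schroeder_steps k)"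
    by (simp add: schroeder_steps_def)
  ultimately show ?thesis
    using finite_lists_length_le finite_subset by blast
qed

text \<open>Lengths of the maximal blocks of consecutive entries \<open>a\<close> of a list, from left to right.\<close>

function block_lengths :: "'a \<Rightarrow> 'a list \<Rightarrow> nat list" where
  "block_lengths a [] = []"
| "block_lengths a (x # xs) =
    (if x = a
     then Suc (length (takeWhile (\<lambda>y. y = a) xs)) # block_lengths a (dropWhile (\<lambda>y. y = a) xs)
     else block_lengths a xs)"
  by pat_completeness auto
termination
  by (relation "measure (length \<circ> snd)") (auto simp: le_imp_less_Suc length_dropWhile_le)

definition up_vector :: "nat \<Rightarrow> (int \<times> int) list \<Rightarrow> nat list" where
  "up_vector k p = block_lengths (1, int k) p"

definition schroeder_sum :: "(nat \<Rightarrow> complex) \<Rightarrow> nat \<Rightarrow> nat \<Rightarrow> complex" where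
  "schroeder_sum f k n =
    (\<Sum>p\<in>schroeder_paths k n. \<Prod>i<length (up_vector k p). f (up_vector k p ! i))"

text \<open>The constant term is 1 whatever the value of \<open>f 0\<close>: the weight is a function on the
  positive integers.\<close>

definition weight_series :: "(nat \<Rightarrow> complex) \<Rightarrow> complex fps" where
  "weight_series f = Abs_fps (\<lambda>l. if l = 0 then 1 else f l)"

end

theory Submission
  imports Defs
begin

text \<open>Let \<open>H = (1 + X) F\<close> and let \<open>B\<close> be the power series solution of \<open>B = H(X B\<^sup>k)\<close>. Lagrange
  inversion for \<open>T = X B\<^sup>k = X H(T)\<^sup>k\<close> gives the coefficients of \<open>B\<close>. To identify \<open>B\<close> with the
  generating function of the paths, consider more generally paths that start at height \<open>h\<close> and whose
  first up steps extend a block of length \<open>j\<close>. Removing the first step yields a recursion for their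
  weighted counts that determines them, and the coefficients of
  \<open>\<Sum>\<^sub>l f(j + l) X\<^sup>l B\<^bsup>h + k l\<^esup> (1 + X B\<^sup>k)\<close>, with \<open>f(0) = 1\<close>, satisfy the same recursion; this
  series is \<open>B\<close> itself for \<open>h = j = 0\<close>.\<close>

section \<open>Lagrange inversion for formal power series\<close>

unbundle fps_syntax

text \<open>\<open>b ^ i\<close> has no terms below degree \<open>i\<close>, so every inner sum may
  run up to \<open>n\<close>, and the two sums can be swapped.\<close>

lemma fps_compose_mult_nth:
  fixes a b c :: "'a::idom fps"
  assumes "b $ 0 = 0"
  shows "((a oo b) * c) $ n = (\<Sum>i\<le>n. a $ i * (b ^ i * c) $ n)"
proof -
  have "((a oo b) * c) $ n = (\<Sum>m\<le>n. (\<Sum>i\<le>m. a $ i * b ^ i $ m) * c $ (n - m))"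
    by (simp add: fps_mult_nth fps_compose_nth atLeast0AtMost)
  also have "\<dots> = (\<Sum>m\<le>n. (\<Sum>i\<le>n. a $ i * b ^ i $ m) * c $ (n - m))"
  proof (rule sum.cong[OF refl])
    fix m assume "m \<in> {..n}"
    then have "(\<Sum>i\<le>m. a $ i * b ^ i $ m) = (\<Sum>i\<le>n. a $ i * b ^ i $ m)"
      using startsby_zero_power_prefix[OF assms] by (intro sum.mono_neutral_left) auto
    then show "(\<Sum>i\<le>m. a $ i * b ^ i $ m) * c $ (n - m) = (\<Sum>i\<le>n. a $ i * b ^ i $ m) * c $ (n - m)"
      by simp
  qed
  also have "\<dots> = (\<Sum>i\<le>n. \<Sum>m\<le>n. a $ i * (b ^ i $ m * c $ (n - m)))"
    unfolding sum_distrib_right by (subst sum.swap) (simp add: mult.assoc)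
  also have "\<dots> = (\<Sum>i\<le>n. a $ i * (b ^ i * c) $ n)"
    by (simp add: fps_mult_nth sum_distrib_left atLeast0AtMost)
  finally show ?thesis .
qed

text \<open>This coefficient is the residue of \<open>G\<^sup>i G' / G\<^bsup>N + 1\<^esup>\<close> for \<open>G = X / P\<close>, which vanishes
  for \<open>i < N\<close> because this is then the derivative of \<open>G\<^bsup>i - N\<^esup> / (i - N)\<close>.\<close>

lemma fps_residue_power_deriv:
  fixes P :: "'a::field_char_0 fps"
  assumes P: "P $ 0 \<noteq> 0" and "i \<le> N"
  defines "G \<equiv> fps_X * inverse P"
  shows "(G ^ i * (fps_deriv G * P ^ Suc N)) $ N = (if i = N then 1 else 0)"
proof -
  define j where "j = N - i"
  have N: "N = i + j" using \<open>i \<le> N\<close> by (simp add: j_def)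
  have inv: "inverse P * P = 1" "P * inverse P = 1"
    using inverse_mult_eq_1[OF P] by (simp_all add: mult.commute)
  have 1: "inverse P ^ i * P ^ i = 1"
    by (simp add: inv flip: power_mult_distrib)
  have "G ^ i = fps_X ^ i * inverse P ^ i" "P ^ Suc N = P ^ i * P ^ Suc j"
    by (simp_all add: G_def N power_mult_distrib power_add mult_ac)
  then have "G ^ i * (fps_deriv G * P ^ Suc N) =
      fps_X ^ i * (fps_deriv G * P ^ Suc j) * (inverse P ^ i * P ^ i)"
    by (simp only: mult_ac)
  also have "\<dots> = fps_X ^ i * (fps_deriv G * P ^ Suc j)"
    by (simp only: 1 mult_1_right)
  finally have GN: "G ^ i * (fps_deriv G * P ^ Suc N) = fps_X ^ i * (fps_deriv G * P ^ Suc j)" .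
  have *: "(G ^ i * (fps_deriv G * P ^ Suc N)) $ N = (fps_deriv G * P ^ Suc j) $ j"
    unfolding GN by (simp add: N fps_X_power_mult_nth del: power_Suc)
  have dG: "fps_deriv G * P ^ Suc j = P ^ j - fps_X * (fps_deriv P * inverse P * P ^ j)"
  proof -
    have "fps_deriv G * P ^ Suc j =
        (P * inverse P) * P ^ j - fps_X * (fps_deriv P * inverse P * P ^ j) * (P * inverse P)"
      by (simp add: G_def fps_inverse_deriv[OF P] algebra_simps power2_eq_square)
    then show ?thesis by (simp only: inv mult_1_left mult_1_right)
  qed
  show ?thesis
  proof (cases j)
    case 0
    then show ?thesis using * dG N P by (simp add: G_def)
  next
    case (Suc l)
    \<comment> \<open>Coefficient \<open>j\<close> of \<open>fps_X * fps_deriv (P ^ j)\<close> is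
      \<open>j\<close> times that of \<open>P ^ j\<close>, so the difference vanishes there, and the
      nonzero factor \<open>j\<close> cancels.\<close>
    have "of_nat j * (fps_deriv G * P ^ Suc j) =
        of_nat j * P ^ j - fps_X * fps_deriv (P ^ j)"
    proof -
      have "of_nat j * (fps_deriv G * P ^ Suc j) =
          of_nat j * P ^ j - fps_X * (of_nat j * fps_deriv P * P ^ l) * (inverse P * P)"
        unfolding dG by (simp add: Suc algebra_simps del: of_nat_Suc)
      moreover have "fps_deriv (P ^ j) = of_nat j * fps_deriv P * P ^ l"
        by (simp only: fps_deriv_power' Suc diff_Suc_1)
      ultimately show ?thesis by (simp only: inv mult_1_right)
    qed
    then have "(of_nat j * (fps_deriv G * P ^ Suc j)) $ j = 0"
      by (simp add: Suc del: of_nat_Suc power_Suc)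
    then have "(fps_deriv G * P ^ Suc j) $ j = 0"
      by (simp add: Suc del: of_nat_Suc)
    then show ?thesis using * N Suc by simp
  qed
qed

text \<open>\<open>T\<close> is the compositional inverse of \<open>G = X / P\<close>. For
  \<open>A = \<Phi> oo T\<close> the chain rule gives \<open>\<Phi>' = (A' oo G) * G'\<close>; after
  multiplication by \<open>P ^ Suc n\<close>, the residue lemma leaves only coefficient
  \<open>n\<close> of \<open>A'\<close>.\<close>

lemma fps_Lagrange_solution:
  fixes P :: "'a::field_char_0 fps"
  assumes P: "P $ 0 \<noteq> 0"
  obtains T where "T $ 0 = 0" "T = fps_X * (P oo T)"
    "\<And>\<Phi> n. of_nat (Suc n) * (\<Phi> oo T) $ Suc n = (fps_deriv \<Phi> * P ^ Suc n) $ n"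
proof -
  define G where "G = fps_X * inverse P"
  have G: "G $ 0 = 0" "G $ 1 \<noteq> 0"
    using P by (simp_all add: G_def)
  define T where "T = fps_inv G"
  have T0: "T $ 0 = 0"
    by (simp add: T_def fps_inv_def)
  have "fps_X = G oo T"
    using fps_inv_right[OF G] by (simp add: T_def)
  also have "\<dots> = T * inverse (P oo T)"
    by (simp add: G_def fps_compose_mult_distrib[OF T0] fps_inverse_compose[OF T0 P] T0)
  finally have T: "T = fps_X * (P oo T)"
    using inverse_mult_eq_1[of "P oo T"] P by (metis fps_compose_nth_0 mult.assoc mult.right_neutral)
  have "of_nat (Suc n) * (\<Phi> oo T) $ Suc n = (fps_deriv \<Phi> * P ^ Suc n) $ n" for \<Phi> n
  proof -
    define A where "A = \<Phi> oo T"
    have "A oo G = \<Phi>"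
      using fps_inv[OF G] by (simp add: A_def T_def fps_compose_assoc[symmetric] G fps_inv_def)
    then have "fps_deriv \<Phi> = (fps_deriv A oo G) * fps_deriv G"
      using fps_compose_deriv[OF G(1)] by metis
    then have "(fps_deriv \<Phi> * P ^ Suc n) $ n =
        (\<Sum>i\<le>n. fps_deriv A $ i * (G ^ i * (fps_deriv G * P ^ Suc n)) $ n)"
      by (simp only: mult.assoc fps_compose_mult_nth[OF G(1)])
    also have "\<dots> = (\<Sum>i\<le>n. if i = n then fps_deriv A $ i else 0)"
      unfolding G_def by (intro sum.cong refl) (simp only: atMost_iff fps_residue_power_deriv[OF P], simp)
    also have "\<dots> = fps_deriv A $ n"
      by simp
    finally show ?thesis by (simp add: A_def)
  qed
  with T0 T show thesis by (rule that)
qed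

text \<open>Lagrange inversion with \<open>P = H ^ k\<close> and \<open>\<Phi> = H\<close> produces
  \<open>H' * H ^ (k * n)\<close>, which is the derivative of \<open>H ^ (k * n + 1)\<close> up to
  the factor \<open>k * n + 1\<close>. It covers only \<open>n > 0\<close>; the constant term is
  \<open>H $ 0\<close>.\<close>

lemma fps_tree_equation_solution:
  fixes H :: "'a::field_char_0 fps" and k :: nat
  assumes H: "H $ 0 = 1"
  obtains B where "B = H oo (fps_X * B ^ k)"
    "\<And>n. B $ n = 1 / of_nat (k * n + 1) * (H ^ (k * n + 1)) $ n"
proof -
  have "(H ^ k) $ 0 \<noteq> 0"
    by (simp add: H fps_nth_power_0)
  then obtain T where T: "T $ 0 = 0" "T = fps_X * (H ^ k oo T)"
    and coeff: "\<And>\<Phi> n. of_nat (Suc n) * (\<Phi> oo T) $ Suc n = (fps_deriv \<Phi> * (H ^ k) ^ Suc n) $ n"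
    using fps_Lagrange_solution[of "H ^ k"] by metis
  define B where "B = H oo T"
  have TB: "T = fps_X * B ^ k"
    using T by (simp add: B_def fps_compose_power)
  have "B $ n = 1 / of_nat (k * n + 1) * (H ^ (k * n + 1)) $ n" for n
  proof (cases n)
    case 0
    then show ?thesis by (simp add: B_def H)
  next
    case (Suc m)
    have "fps_deriv (H ^ (k * n + 1)) = of_nat (k * n + 1) * (fps_deriv H * (H ^ k) ^ n)"
      using fps_deriv_power'[of H "k * n + 1"]
      by (simp only: add_diff_cancel_right' power_mult mult.assoc)
    then have "of_nat (k * n + 1) * (fps_deriv H * (H ^ k) ^ n) $ m = of_nat n * (H ^ (k * n + 1)) $ n"
      using fps_deriv_nth[of "H ^ (k * n + 1)" m]
      by (metis Suc Suc_eq_plus1 fps_mult_of_nat_nth(1))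
    then have "of_nat (k * n + 1) * (of_nat n * B $ n) = of_nat n * (H ^ (k * n + 1)) $ n"
      using coeff[of m H] by (simp add: B_def Suc)
    moreover have nz: "(of_nat n :: 'a) \<noteq> 0" "(of_nat (k * n + 1) :: 'a) \<noteq> 0"
      using Suc by (simp_all del: of_nat_add of_nat_mult of_nat_Suc)
    ultimately have "of_nat (k * n + 1) * B $ n = (H ^ (k * n + 1)) $ n"
      by (metis mult.left_commute mult_cancel_left)
    then show ?thesis
      using nz(2) by (simp only: times_divide_eq_left mult_1_left eq_divide_eq) (simp only: mult.commute if_False not_False_eq_True if_True)
  qed
  with TB show thesis
    by (intro that[of B]) (simp_all add: B_def)
qed

section \<open>Block lengths and paths starting at height \<open>h\<close>\<close>

lemma block_lengths_replicate:
  "block_lengths a (replicate j a) = (if j = 0 then [] else [j])"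
  by (cases j) simp_all

lemma block_lengths_replicate_Cons:
  assumes "b \<noteq> a"
  shows "block_lengths a (replicate j a @ b # p) = (if j = 0 then [] else [j]) @ block_lengths a p"
proof (cases j)
  case (Suc i)
  have "takeWhile (\<lambda>y. y = a) (replicate i a @ b # p) = replicate i a"
    "dropWhile (\<lambda>y. y = a) (replicate i a @ b # p) = b # p"
    using assms by (induction i) auto
  with Suc assms show ?thesis by simp
qed (use assms in simp)

text \<open>Hence \<open>f 0\<close> never enters a weight and may be replaced by 1.\<close>

lemma block_lengths_pos: "l \<in> set (block_lengths a p) \<Longrightarrow> 0 < l"
  by (induction a p rule: block_lengths.induct) (auto split: if_splits)

text \<open>The sum of both coordinates grows by \<open>k + 1\<close> along each rise
  \<open>(1, k)\<close> or \<open>(2, k - 1)\<close> and is constant along \<open>(1, -1)\<close>;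
  thus \<open>n\<close> is the number of rises.\<close>

definition paths_from :: "nat \<Rightarrow> nat \<Rightarrow> nat \<Rightarrow> (int \<times> int) list set" where
  "paths_from k h n =
    {p. set p \<subseteq> schroeder_steps k
      \<and> (\<Sum>s\<leftarrow>p. fst s) = int ((k + 1) * n + h)
      \<and> (\<Sum>s\<leftarrow>p. snd s) = - int h
      \<and> (\<forall>m \<le> length p. 0 \<le> int h + (\<Sum>s\<leftarrow>take m p. snd s))}"

lemma schroeder_paths_eq: "schroeder_paths k n = paths_from k 0 n"
  by (simp add: schroeder_paths_def paths_from_def)

lemma all_le_Suc_iff: "(\<forall>m\<le>Suc n. Q m) \<longleftrightarrow> Q 0 \<and> (\<forall>m\<le>n. Q (Suc m))"
  by (metis Suc_le_mono le0 not0_implies_Suc)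

text \<open>Rules out a rise when \<open>n = 0\<close>: the coordinate sum would be positive after
  it and could not return to 0.\<close>

lemma sum_steps_nonneg:
  "set p \<subseteq> schroeder_steps k \<Longrightarrow> 0 \<le> (\<Sum>s\<leftarrow>p. fst s) + (\<Sum>s\<leftarrow>p. snd s)"
  by (induction p) (auto simp: schroeder_steps_def)

lemma Nil_in_paths_from: "[] \<in> paths_from k h n \<longleftrightarrow> h = 0 \<and> n = 0"
  by (auto simp: paths_from_def simp del: of_nat_add of_nat_mult of_nat_Suc)

lemma down_in_paths_from:
  "(1, -1) # p \<in> paths_from k h n \<longleftrightarrow> 0 < h \<and> p \<in> paths_from k (h - 1) n"
proof (cases h)
  case 0
  then show ?thesis
    \<comment> \<open>The vertex right after the step would lie at height -1.\<close>
    by (auto simp: paths_from_def all_le_Suc_iff dest!: spec[of _ 0])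
next
  case (Suc h')
  then show ?thesis
    by (auto simp: paths_from_def all_le_Suc_iff schroeder_steps_def algebra_simps)
qed

lemma rise_in_paths_from:
  assumes s: "s \<in> schroeder_steps k" "fst s + snd s = int k + 1"
  assumes h': "int h' = int h + snd s"
  shows "s # p \<in> paths_from k h n \<longleftrightarrow> 0 < n \<and> p \<in> paths_from k h' (n - 1)"
proof (cases n)
  case 0
  have "False" if "s # p \<in> paths_from k h 0"
    using that sum_steps_nonneg[of p k] s by (auto simp: paths_from_def)
  then show ?thesis using 0 by auto
next
  case (Suc m)
  have "(\<forall>i\<le>length (s # p). 0 \<le> int h + (\<Sum>s\<leftarrow>take i (s # p). snd s)) \<longleftrightarrow>
      (\<forall>i\<le>length p. 0 \<le> int h' + (\<Sum>s\<leftarrow>take i p. snd s))"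
    by (simp add: all_le_Suc_iff h' add.assoc)
  moreover have "fst s + z = int ((k + 1) * Suc m + h) \<longleftrightarrow> z = int ((k + 1) * m + h')" for z
    using s(2) h' by (auto simp: algebra_simps)
  moreover have "snd s + z = - int h \<longleftrightarrow> z = - int h'" for z
    using h' by auto
  ultimately show ?thesis
    using s(1) Suc by (simp add: paths_from_def)
qed

lemma paths_from_rec:
  assumes "k > 0"
  shows "paths_from k h n =
    (if h = 0 \<and> n = 0 then {[]} else {}) \<union>
    (if h > 0 then Cons (1, -1) ` paths_from k (h - 1) n else {}) \<union>
    (if n > 0 then Cons (1, int k) ` paths_from k (h + k) (n - 1) else {}) \<union>
    (if n > 0 then Cons (2, int k - 1) ` paths_from k (h + k - 1) (n - 1) else {})"
    (is "_ = ?R")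
proof (intro set_eqI)
  fix p
  show "p \<in> paths_from k h n \<longleftrightarrow> p \<in> ?R"
  proof (cases p)
    case Nil
    then show ?thesis by (auto simp: Nil_in_paths_from)
  next
    case (Cons s q)
    have U: "(1, int k) # q \<in> paths_from k h n \<longleftrightarrow> 0 < n \<and> q \<in> paths_from k (h + k) (n - 1)"
      by (rule rise_in_paths_from) (simp_all add: schroeder_steps_def)
    have H: "(2, int k - 1) # q \<in> paths_from k h n \<longleftrightarrow>
        0 < n \<and> q \<in> paths_from k (h + k - 1) (n - 1)"
      \<comment> \<open>\<open>k > 0\<close> makes the truncated difference \<open>h + k - 1\<close>
        the true height.\<close>
      using assms by (intro rise_in_paths_from) (auto simp: schroeder_steps_def)
    have "s = (1, int k) \<or> s = (2, int k - 1) \<or> s = (1, -1)" if "p \<in> paths_from k h n"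
      using that by (auto simp: Cons paths_from_def schroeder_steps_def)
    then show ?thesis
      using U H down_in_paths_from[of q k h n] unfolding Cons by auto
  qed
qed

lemma sum_paths_from_rec:
  fixes w :: "(int \<times> int) list \<Rightarrow> 'a::comm_monoid_add"
  assumes "k > 0"
  shows "(\<Sum>p\<in>paths_from k h n. w p) =
    (if h = 0 \<and> n = 0 then w [] else 0) +
    (if h > 0 then \<Sum>p\<in>paths_from k (h - 1) n. w ((1, -1) # p) else 0) +
    (if n > 0 then \<Sum>p\<in>paths_from k (h + k) (n - 1). w ((1, int k) # p) else 0) +
    (if n > 0 then \<Sum>p\<in>paths_from k (h + k - 1) (n - 1). w ((2, int k - 1) # p) else 0)"
proof -
  \<comment> \<open>Rises lower \<open>n\<close>; down steps keep \<open>n\<close> and lower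
    \<open>h\<close>. Hence the nested induction.\<close>
  have fin: "finite (paths_from k h n)" for h n
  proof (induction n arbitrary: h)
    case 0
    show ?case
      by (induction h; subst paths_from_rec[OF assms]) auto
  next
    case (Suc n)
    then have IH: "finite (paths_from k h n)" for h .
    show ?case
      by (induction h; subst paths_from_rec[OF assms]) (auto simp: IH)
  qed
  show ?thesis
    by (subst paths_from_rec[OF assms], subst sum.union_disjoint,
        (auto simp: fin)[3], subst sum.union_disjoint, (auto simp: fin)[3],
        subst sum.union_disjoint, (auto simp: fin)[3])
      (simp add: sum.reindex inj_on_def)
qed

section \<open>Weighted path counts as coefficients\<close>

text \<open>Keeping track of the length \<open>j\<close> of the unfinished block makes the weight computable step by step.\<close>

definition path_weight :: "(nat \<Rightarrow> 'a::comm_ring_1) \<Rightarrow> nat \<Rightarrow> nat \<Rightarrow> (int \<times> int) list \<Rightarrow> 'a" where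
  "path_weight g k j p = prod_list (map g (up_vector k (replicate j (1, int k) @ p)))"

lemma path_weight_up [simp]:
  "path_weight g k j ((1, int k) # p) = path_weight g k (Suc j) p"
  by (simp add: path_weight_def replicate_app_Cons_same)

text \<open>With \<open>g 0 = 1\<close> an empty pending block also contributes \<open>g j\<close>,
  so \<open>j = 0\<close> needs no separate case.\<close>

lemma path_weight_Nil [simp]:
  "g 0 = 1 \<Longrightarrow> path_weight g k j [] = g j"
  by (simp add: path_weight_def up_vector_def block_lengths_replicate)

lemma path_weight_other [simp]:
  "g 0 = 1 \<Longrightarrow> s \<noteq> (1, int k) \<Longrightarrow> path_weight g k j (s # p) = g j * path_weight g k 0 p"
  by (simp add: path_weight_def up_vector_def block_lengths_replicate_Cons)

text \<open>In the series on the right, a path is read as a block of \<open>l\<close> further up steps, possibly a step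
  \<open>(2, k - 1)\<close>, and then one factor \<open>B\<close> for each level to descend.\<close>

lemma sum_path_weight:
  fixes g :: "nat \<Rightarrow> complex"
  assumes k: "k > 0" and g0: "g 0 = 1"
  assumes B: "B = (Abs_fps g oo (fps_X * B ^ k)) * (1 + fps_X * B ^ k)"
  shows "(\<Sum>p\<in>paths_from k h n. path_weight g k j p) =
    (B ^ h * ((fps_shift j (Abs_fps g) oo (fps_X * B ^ k)) * (1 + fps_X * B ^ k))) $ n"
proof -
  define Z where "Z = fps_X * B ^ k"
  define A where "A j h = B ^ h * ((fps_shift j (Abs_fps g) oo Z) * (1 + Z))" for j h
  have Z0: "Z $ 0 = 0" by (simp add: Z_def)
  have A0: "A 0 h = B ^ Suc h" for h
    using B by (simp add: A_def Z_def mult.commute)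
  have shift: "fps_shift j (Abs_fps g) = fps_const (g j) + fps_X * fps_shift (Suc j) (Abs_fps g)" for j
    by (rule fps_ext) auto
  \<comment> \<open>Splitting off \<open>g j\<close> separates ending the block from extending it;
    once it has ended, the factor \<open>1 + Z\<close> decides whether a step
    \<open>(2, k - 1)\<close> follows.\<close>
  have A_rec: "A j h = fps_const (g j) * B ^ h + fps_const (g j) * (fps_X * B ^ (h + k)) +
      fps_X * A (Suc j) (h + k)" for j h
    unfolding A_def by (subst shift)
      (simp add: fps_compose_add_distrib fps_compose_mult_distrib[OF Z0] Z0,
       simp add: power_add Z_def algebra_simps)
  have rec: "(\<Sum>p\<in>paths_from k h n. path_weight g k j p) =
      (if h = 0 \<and> n = 0 then g j else 0) +
      (if h > 0 then g j * (\<Sum>p\<in>paths_from k (h - 1) n. path_weight g k 0 p) else 0) +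
      (if n > 0 then \<Sum>p\<in>paths_from k (h + k) (n - 1). path_weight g k (Suc j) p else 0) +
      (if n > 0 then g j * (\<Sum>p\<in>paths_from k (h + k - 1) (n - 1). path_weight g k 0 p) else 0)"
    for j h n
    by (subst sum_paths_from_rec[OF k]) (simp add: g0 sum_distrib_left)
  have "(\<Sum>p\<in>paths_from k h n. path_weight g k j p) = A j h $ n"
  \<comment> \<open>Nested induction as for finiteness; \<open>j\<close> stays arbitrary because up
    steps increase it and the other steps reset it to 0.\<close>
  proof (induction n arbitrary: h j rule: less_induct)
    case (less n)
    have rise: "(if n > 0 then \<Sum>p\<in>paths_from k (h + k) (n - 1). path_weight g k (Suc j) p else 0) +
        (if n > 0 then g j * (\<Sum>p\<in>paths_from k (h + k - 1) (n - 1). path_weight g k 0 p) else 0) =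
        (fps_X * A (Suc j) (h + k) + fps_const (g j) * (fps_X * B ^ (h + k))) $ n" for h j
      \<comment> \<open>As \<open>k > 0\<close>, \<open>A 0 (h + k - 1)\<close> is
        \<open>B ^ (h + k)\<close>.\<close>
      using less[of "n - 1"] k A0[of "h + k - 1"] by auto
    show ?case
    proof (induction h arbitrary: j)
      case 0
      show ?case
        unfolding rec[where h = 0 and n = n] A_rec[where h = 0] add.assoc rise by (simp add: add_ac)
    next
      case (Suc h)
      show ?case
        unfolding rec[where h = "Suc h" and n = n] A_rec[where h = "Suc h"] add.assoc rise using Suc[of 0] A0[of h] by (simp add: add_ac)
    qed
  qed
  then show ?thesis by (simp add: A_def Z_def)
qed

section \<open>Back to Schroeder paths\<close>

lemma prod_list_map_nth: "(\<Prod>i<length xs. f (xs ! i)) = prod_list (map f xs)"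
  by (induction xs) (simp_all add: prod.lessThan_Suc_shift del: prod.lessThan_Suc)

lemma schroeder_sum_eq:
  "schroeder_sum f k n =
    (\<Sum>p\<in>paths_from k 0 n. path_weight (fps_nth (weight_series f)) k 0 p)"
proof -
  have "(\<Prod>i<length (up_vector k p). f (up_vector k p ! i)) =
      path_weight (fps_nth (weight_series f)) k 0 p" for p
  proof -
    have "map (fps_nth (weight_series f)) (up_vector k p) = map f (up_vector k p)"
      by (rule map_cong) (auto simp: up_vector_def weight_series_def dest: block_lengths_pos)
    then show ?thesis
      by (simp only: path_weight_def prod_list_map_nth replicate_0 append_Nil)
  qed
  then show ?thesis
    by (simp add: schroeder_sum_def schroeder_paths_eq)
qed

theorem theorem4p1:
  fixes f :: "nat \<Rightarrow> complex" and k :: nat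
  assumes "k > 0"
  shows "(\<forall>n. schroeder_sum f k n =
            1 / of_nat (k * n + 1) *
              fps_nth ((1 + fps_X) ^ (k * n + 1) * weight_series f ^ (k * n + 1)) n) \<and>
         (let S = Abs_fps (schroeder_sum f k) in
            S = fps_compose (weight_series f) (fps_X * S ^ k) * (1 + fps_X * S ^ k))"
proof -
  define F where "F = weight_series f"
  have F0: "F $ 0 = 1" by (simp add: F_def weight_series_def)
  obtain B where B: "B = ((1 + fps_X) * F) oo (fps_X * B ^ k)"
    and coeff: "\<And>n. B $ n = 1 / of_nat (k * n + 1) * (((1 + fps_X) * F) ^ (k * n + 1)) $ n"
    using fps_tree_equation_solution[of "(1 + fps_X) * F" k] F0 by auto
  have eq: "B = (F oo (fps_X * B ^ k)) * (1 + fps_X * B ^ k)"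
    by (subst B) (simp add: fps_compose_mult_distrib fps_compose_add_distrib mult.commute)
  have "schroeder_sum f k n = B $ n" for n
    using sum_path_weight[of k "fps_nth F" B 0 0 n] eq
    by (simp add: schroeder_sum_eq assms F0 fps_nth_inverse flip: F_def)
  then have "Abs_fps (schroeder_sum f k) = B" "\<forall>n. schroeder_sum f k n = B $ n"
    by (auto intro: fps_ext)
  then show ?thesis
    using eq coeff unfolding Let_def power_mult_distrib F_def by simp
qed

end
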